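(* Let $n\in\{2,3\}$, $\mu>0$ and let $(\rho,u,\theta,q,S_2)$, with $\rho,\theta>0$, be a local (smooth) solution of $$\begin{cases} \partial_t\rho+\mathrm{div}(\rho u)=0,\\ \rho\partial_t u+\rho u\cdot\nabla u+\nabla p=\mu\,\mathrm{div}\left(\nabla u+\nabla u^T-\frac2n \mathrm{div}u\, I_n\right)+\nabla S_2,\\ \rho\partial_t e+\rho u\cdot\nabla e+p\,\mathrm{div}u+\mathrm{div}q=\mu\left(\nabla u+\nabla u^T-\frac2n\mathrm{div}u\,I_n\right):\nabla u+S_2\,\mathrm{div}u,\\ \tau_1(\partial_t q+u\cdot\nabla q)+q+\kappa\nabla\theta=0,\\ \tau_3(\partial_t S_2+u\cdot\nabla S_2)+S_2=\lambda\,\mathrm{div}u, \end{cases}$$ where $e=C_v\theta+\frac{\tau_1}{\kappa\rho\theta}q^2+\frac{\tau_3}{2\lambda\rho}S_2^2$ and $p=R\rho\theta-\frac{\tau_1}{2\kappa\theta}q^2-\frac{\tau_3}{2\lambda}S_2^2$. Define $$\eta:=C_v\ln\theta-R\ln\rho+\frac{\tau_1}{2\kappa\theta^2\rho}q^2,\qquad S_1:=\mu\left(\nabla u+\nabla u^T-\frac2n\mathrm{div}u\,I_n\right).$$ Then $$\partial_t(\rho\eta)+\mathrm{div}(\rho u\eta)+\mathrm{div}\left(\frac q\theta\right)=\frac{q^2}{\kappa\theta^2}+\frac{S_2^2}{\theta\lambda}+\frac{S_1^2}{2\mu\theta}.$$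
   Context: The unknowns take values $(\rho,u,\theta,q,S_2)\in\mathbb R_+\times\mathbb R^n\times\mathbb R_+\times\mathbb R^n\times\mathbb R$ and depend on $(x,t)$, $x\in\mathbb R^n$. $\tau_1,\tau_3,\kappa,\lambda,C_v,R$ are positive constants. $q^2=|q|^2$; for matrices $A:B=\sum_{j,k}a_{jk}b_{jk}$ and $S_1^2=S_1:S_1$; $I_n$ is the identity matrix. *)

theory Defs
  imports "HOL-Analysis.Analysis"
begin

text \<open>
  Fields on space-time are functions of \<open>x :: real ^ 'n\<close> and \<open>t :: real\<close>, in this order. The spatial
  operators below act on a function of \<open>x\<close> alone, that is, on a field with the time frozen.
\<close>

definition partial_deriv ::
  "'n::finite \<Rightarrow> (real ^ 'n \<Rightarrow> 'b::real_normed_vector) \<Rightarrow> real ^ 'n \<Rightarrow> 'b" where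
  "partial_deriv j f x = vector_derivative (\<lambda>s. f (x + s *\<^sub>R axis j 1)) (at 0)"

definition time_deriv ::
  "('a \<Rightarrow> real \<Rightarrow> 'b::real_normed_vector) \<Rightarrow> 'a \<Rightarrow> real \<Rightarrow> 'b" where
  "time_deriv f x t = vector_derivative (f x) (at t)"

definition grad :: "(real ^ 'n::finite \<Rightarrow> real) \<Rightarrow> real ^ 'n \<Rightarrow> real ^ 'n" where
  "grad f x = (\<chi> j. partial_deriv j f x)"

text \<open>Row \<open>i\<close>, column \<open>j\<close> of the velocity gradient is the \<open>j\<close>-th partial derivative of \<open>v\<^sub>i\<close>.\<close>

definition grad_vec :: "(real ^ 'n::finite \<Rightarrow> real ^ 'n) \<Rightarrow> real ^ 'n \<Rightarrow> real ^ 'n ^ 'n" where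
  "grad_vec v x = (\<chi> i j. partial_deriv j (\<lambda>y. v y $ i) x)"

definition divergence :: "(real ^ 'n::finite \<Rightarrow> real ^ 'n) \<Rightarrow> real ^ 'n \<Rightarrow> real" where
  "divergence v x = (\<Sum>j\<in>UNIV. partial_deriv j (\<lambda>y. v y $ j) x)"

text \<open>Row-wise divergence of a matrix field.\<close>

definition divergence_mat ::
  "(real ^ 'n::finite \<Rightarrow> real ^ 'n ^ 'n) \<Rightarrow> real ^ 'n \<Rightarrow> real ^ 'n" where
  "divergence_mat A x = (\<chi> i. \<Sum>j\<in>UNIV. partial_deriv j (\<lambda>y. A y $ i $ j) x)"

text \<open>The operator \<open>v \<cdot> \<nabla>\<close>, applied to a scalar or to a vector field.\<close>

definition advect ::
  "real ^ 'n::finite \<Rightarrow> (real ^ 'n \<Rightarrow> 'b::real_normed_vector) \<Rightarrow> real ^ 'n \<Rightarrow> 'b" where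
  "advect v f x = (\<Sum>j\<in>UNIV. v $ j *\<^sub>R partial_deriv j f x)"

definition ddot :: "real ^ 'n::finite ^ 'n \<Rightarrow> real ^ 'n ^ 'n \<Rightarrow> real" where
  "ddot A B = (\<Sum>j\<in>UNIV. \<Sum>k\<in>UNIV. A $ j $ k * B $ j $ k)"

definition deviator :: "(real ^ 'n::finite \<Rightarrow> real ^ 'n) \<Rightarrow> real ^ 'n \<Rightarrow> real ^ 'n ^ 'n" where
  "deviator v x =
     grad_vec v x + transpose (grad_vec v x) - (2 / real CARD('n) * divergence v x) *\<^sub>R mat 1"

definition cont_diff_on ::
  "('a::real_normed_vector \<Rightarrow> 'b::real_normed_vector) \<Rightarrow> 'a set \<Rightarrow> bool" where
  "cont_diff_on f S \<longleftrightarrow>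
     (\<exists>f' :: 'a \<Rightarrow> 'a \<Rightarrow>\<^sub>L 'b.
        (\<forall>z\<in>S. (f has_derivative blinfun_apply (f' z)) (at z)) \<and> continuous_on S f')"

text \<open>
  Classical regularity on \<open>\<real>\<^sup>n \<times> (0, T)\<close>: every field is of class \<open>C\<^sup>1\<close> in \<open>(x, t)\<close> and the velocity,
  the only field differentiated twice, is moreover of class \<open>C\<^sup>2\<close> in \<open>x\<close>. In particular every
  derivative in the system exists, so the total operator \<^const>\<open>vector_derivative\<close> never
  takes an unspecified value there.
\<close>

definition classical_regularity ::
  "real \<Rightarrow> (real ^ 'n::finite \<Rightarrow> real \<Rightarrow> real) \<Rightarrow> (real ^ 'n \<Rightarrow> real \<Rightarrow> real ^ 'n) \<Rightarrow>
   (real ^ 'n \<Rightarrow> real \<Rightarrow> real) \<Rightarrow> (real ^ 'n \<Rightarrow> real \<Rightarrow> real ^ 'n) \<Rightarrow>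
   (real ^ 'n \<Rightarrow> real \<Rightarrow> real) \<Rightarrow> bool" where
  "classical_regularity T \<rho> u \<theta> q S2 \<longleftrightarrow>
     (let Q = UNIV \<times> {0<..<T} in
        cont_diff_on (\<lambda>(x, t). \<rho> x t) Q \<and>
        cont_diff_on (\<lambda>(x, t). u x t) Q \<and>
        cont_diff_on (\<lambda>(x, t). \<theta> x t) Q \<and>
        cont_diff_on (\<lambda>(x, t). q x t) Q \<and>
        cont_diff_on (\<lambda>(x, t). S2 x t) Q) \<and>
     (\<forall>t\<in>{0<..<T}. \<forall>j. cont_diff_on (partial_deriv j (\<lambda>x. u x t)) UNIV)"

end

theory Submission
  imports Defs
begin

text \<open>
  The material derivative is the derivative along the straight space-time curve
  \<open>s \<mapsto> (x + s u, t + s)\<close>, so the chain rules for \<open>e\<close> and \<open>\<eta>\<close> are one-variable computations. Mass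
  conservation turns the left-hand side into \<open>\<rho> D\<eta> + div (q / \<theta>)\<close>. Comparing \<open>\<theta> \<rho> D\<eta>\<close> with
  \<open>\<rho> De + p div u\<close>, the difference is \<open>(\<tau>\<^sub>1 / (\<kappa> \<theta>)) q \<cdot> Dq + (\<tau>\<^sub>3 / \<lambda>) S\<^sub>2 DS\<^sub>2\<close>, which the two
  relaxation equations evaluate. The viscous dissipation is a square because the deviator is symmetric
  and trace-free.
\<close>

section \<open>Derivatives along lines in space and in space-time\<close>

text \<open>Chain rule through an affine map. The parameter \<open>c\<close> stays free because the
  time derivative is taken at \<open>s = t\<close> on a line based at \<open>(x, 0)\<close>, while
  all other uses have \<open>c = 0\<close>.\<close>

lemma has_vector_derivative_along_line:
  assumes "(f has_derivative f') (at (a + c *\<^sub>R v))"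
  shows "((\<lambda>s. f (a + s *\<^sub>R v)) has_vector_derivative f' v) (at c)"
proof -
  have "((\<lambda>s. a + s *\<^sub>R v) has_vector_derivative v) (at c)"
    by (auto intro!: derivative_eq_intros simp: has_vector_derivative_def)
  moreover have "(f has_derivative f') (at (a + c *\<^sub>R v) within range (\<lambda>s. a + s *\<^sub>R v))"
    using assms by (rule has_derivative_at_withinI)
  ultimately show ?thesis
    using vector_derivative_diff_chain_within[of "\<lambda>s. a + s *\<^sub>R v" v c UNIV f f']
    by (simp add: o_def)
qed

lemma partial_deriv_eq_derivative:
  assumes "(f has_derivative f') (at x)"
  shows "partial_deriv j f x = f' (axis j 1)"
  using has_vector_derivative_along_line[of f f' x 0 "axis j 1"] assms
  by (simp add: partial_deriv_def vector_derivative_at)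

text \<open>Expanding \<open>v\<close> in the standard basis and using linearity of
  \<open>f'\<close> identifies the coordinate sum with a directional derivative.\<close>

lemma advect_eq_derivative:
  assumes "(f has_derivative f') (at x)"
  shows "advect v f x = f' v"
proof -
  interpret bounded_linear f' using assms by (rule has_derivative_bounded_linear)
  have "advect v f x = f' (\<Sum>j\<in>UNIV. v $ j *\<^sub>R axis j 1)"
    by (simp add: advect_def partial_deriv_eq_derivative[OF assms] sum scaleR)
  also have "(\<Sum>j\<in>UNIV. v $ j *\<^sub>R axis j 1) = v"
    using basis_expansion[of v] by (simp add: scalar_mult_eq_scaleR)
  finally show ?thesis .
qed

lemma has_vector_derivative_advect:
  assumes "f differentiable (at x)"
  shows "((\<lambda>s. f (x + s *\<^sub>R v)) has_vector_derivative advect v f x) (at 0)"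
proof -
  obtain f' where f': "(f has_derivative f') (at x)"
    using assms by (auto simp: differentiable_def)
  then show ?thesis
    using has_vector_derivative_along_line[of f f' x 0 v] by (simp add: advect_eq_derivative[OF f'])
qed

lemma differentiable_time_slice:
  assumes "(\<lambda>(x, t). f x t) differentiable (at (x, t))"
  shows "(\<lambda>y. f y t) differentiable (at x)"
proof -
  have "(\<lambda>y. (y, t)) differentiable (at x)"
    unfolding differentiable_def by (auto intro!: exI derivative_eq_intros)
  from differentiable_chain_at[OF this, of "\<lambda>(x, t). f x t"] assms
  show ?thesis by (simp add: o_def)
qed

text \<open>The direction \<open>(v, 1)\<close> splits as \<open>(0, 1) + (v, 0)\<close>, and
  \<open>f'\<close> is additive. Only first derivatives at one point are involved, so a frozen
  \<open>v\<close> suffices and no particle trajectory has to be solved for.\<close>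

lemma has_vector_derivative_material:
  fixes f :: "real ^ 'n::finite \<Rightarrow> real \<Rightarrow> 'b::real_normed_vector"
  assumes "(\<lambda>(x, t). f x t) differentiable (at (x, t))"
  shows "((\<lambda>s. f (x + s *\<^sub>R v) (t + s)) has_vector_derivative
           time_deriv f x t + advect v (\<lambda>y. f y t) x) (at 0)"
proof -
  obtain f' where f': "((\<lambda>(x, t). f x t) has_derivative f') (at (x, t))"
    using assms by (auto simp: differentiable_def)
  interpret bounded_linear f' using f' by (rule has_derivative_bounded_linear)
  have "((\<lambda>s. f x s) has_vector_derivative f' (0, 1)) (at t)"
    using has_vector_derivative_along_line[of "\<lambda>(x, t). f x t" f' "(x, 0)" t "(0, 1)"] f' by simp
  then have time: "time_deriv f x t = f' (0, 1)"
    by (simp add: time_deriv_def vector_derivative_at)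
  have "((\<lambda>y. f y t) has_derivative (\<lambda>h. f' (h, 0))) (at x)"
    using has_derivative_compose[of "\<lambda>y. (y, t)" "\<lambda>h. (h, 0)" x UNIV "\<lambda>(x, t). f x t" f'] f'
    by (simp add: has_derivative_Pair)
  then have space: "advect v (\<lambda>y. f y t) x = f' (v, 0)"
    by (rule advect_eq_derivative)
  have "time_deriv f x t + advect v (\<lambda>y. f y t) x = f' (v, 1)"
    by (simp add: time space flip: add)
  then show ?thesis
    using has_vector_derivative_along_line[of "\<lambda>(x, t). f x t" f' "(x, t)" 0 "(v, 1)"] f' by simp
qed

section \<open>Product rule for the divergence and differentiability of composites\<close>

text \<open>Used for three fluxes: mass (\<open>f = \<rho>\<close>), entropy
  (\<open>f = \<rho> \<eta>\<close>) and \<open>q / \<theta>\<close>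
  (\<open>f = 1 / \<theta>\<close>).\<close>

lemma divergence_scaleR:
  fixes f :: "real ^ 'n::finite \<Rightarrow> real"
  assumes "f differentiable (at x)" and "v differentiable (at x)"
  shows "divergence (\<lambda>y. f y *\<^sub>R v y) x = f x * divergence v x + advect (v x) f x"
proof -
  obtain f' v' where f': "(f has_derivative f') (at x)" and v': "(v has_derivative v') (at x)"
    using assms by (auto simp: differentiable_def)
  have v'_nth: "((\<lambda>y. v y $ j) has_derivative (\<lambda>h. v' h $ j)) (at x)" for j
    using v' by (rule bounded_linear.has_derivative[OF bounded_linear_vec_nth])
  have "((\<lambda>y. (f y *\<^sub>R v y) $ j) has_derivative (\<lambda>h. f x * v' h $ j + f' h * v x $ j)) (at x)" for j
    using has_derivative_mult[OF f' v'_nth] by simp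
  from partial_deriv_eq_derivative[OF this] show ?thesis
    by (simp add: divergence_def advect_def partial_deriv_eq_derivative[OF f']
        partial_deriv_eq_derivative[OF v'_nth] sum.distrib sum_distrib_left mult.commute)
qed

lemma inner_grad:
  fixes f :: "real ^ 'n::finite \<Rightarrow> real"
  shows "v \<bullet> grad f x = advect v f x"
  by (simp add: inner_vec_def grad_def advect_def)

lemma cont_diff_on_imp_differentiable:
  assumes "cont_diff_on f S" and "z \<in> S"
  shows "f differentiable (at z)"
  using assms by (auto simp: cont_diff_on_def differentiable_def)

lemma differentiable_ln:
  fixes f :: "'a::real_normed_vector \<Rightarrow> real"
  assumes "f differentiable (at z)" and "f z > 0"
  shows "(\<lambda>z. ln (f z)) differentiable (at z)"
  using assms has_derivative_ln[of f z] by (auto simp: differentiable_def)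

section \<open>Viscous dissipation as a square\<close>

text \<open>Write \<open>A = G + G^T - c I\<close>. Symmetry of \<open>A\<close> gives
  \<open>A : G^T = A : G\<close>, and its zero trace gives \<open>A : I = 0\<close>.\<close>

lemma ddot_deviator_self:
  fixes v :: "real ^ 'n::finite \<Rightarrow> real ^ 'n"
  shows "ddot (deviator v x) (deviator v x) = 2 * ddot (deviator v x) (grad_vec v x)"
proof -
  define A G where "A = deviator v x" and "G = grad_vec v x"
  define c where "c = 2 / real CARD('n) * divergence v x"
  have A: "A $ j $ k = G $ j $ k + G $ k $ j - c * (if j = k then 1 else 0)" for j k
    by (simp add: A_def G_def deviator_def transpose_def mat_def c_def)
  have sym: "A $ j $ k = A $ k $ j" for j k
    by (simp add: A)
  have "(\<Sum>j\<in>UNIV. G $ j $ j) = divergence v x"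
    by (simp add: G_def grad_vec_def divergence_def)
  \<comment> \<open>The trace is \<open>2 div v - c n\<close>, where \<open>n\<close> is the
    dimension; the factor \<open>2 / n\<close> in the deviator makes it vanish.\<close>
  then have tracefree: "(\<Sum>j\<in>UNIV. A $ j $ j) = 0"
    by (simp add: A sum.distrib sum_subtractf c_def flip: sum_distrib_left)
  have "(\<Sum>j\<in>UNIV. \<Sum>k\<in>UNIV. A $ j $ k * G $ k $ j) = (\<Sum>j\<in>UNIV. \<Sum>k\<in>UNIV. A $ k $ j * G $ k $ j)"
    using sym by simp
  also have "\<dots> = ddot A G"
    unfolding ddot_def by (rule sum.swap)
  finally have transposed: "(\<Sum>j\<in>UNIV. \<Sum>k\<in>UNIV. A $ j $ k * G $ k $ j) = ddot A G" .
  have "(\<Sum>j\<in>UNIV. \<Sum>k\<in>UNIV. A $ j $ k * (c * (if j = k then 1 else 0)))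
      = (\<Sum>j\<in>UNIV. A $ j $ j * c)"
    by (intro sum.cong refl) (simp add: if_distrib cong: if_cong)
  also have "\<dots> = 0"
    using tracefree by (simp flip: sum_distrib_right)
  finally have identity: "(\<Sum>j\<in>UNIV. \<Sum>k\<in>UNIV. A $ j $ k * (c * (if j = k then 1 else 0))) = 0" .
  have "ddot A A = (\<Sum>j\<in>UNIV. \<Sum>k\<in>UNIV. A $ j $ k *
      (G $ j $ k + G $ k $ j - c * (if j = k then 1 else 0)))"
    by (simp add: ddot_def flip: A)
  also have "\<dots> = ddot A G + ddot A G - 0"
    unfolding distrib_left right_diff_distrib sum.distrib sum_subtractf transposed identity
    by (simp add: ddot_def)
  finally show ?thesis
    by (simp add: A_def G_def)
qed

section \<open>Energy and entropy as functions of one variable\<close>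

text \<open>Passing to the inner product avoids the norm itself, which is not differentiable at
  zero, so points where \<open>Q\<close> vanishes need no separate treatment.\<close>

lemma has_real_derivative_norm_power2:
  fixes Q :: "real \<Rightarrow> 'a::real_inner"
  assumes "(Q has_vector_derivative Q') (at a)"
  shows "((\<lambda>s. (norm (Q s))\<^sup>2) has_real_derivative 2 * (Q a \<bullet> Q')) (at a)"
proof -
  have "((\<lambda>s. Q s \<bullet> Q s) has_derivative (\<lambda>h. Q a \<bullet> (h *\<^sub>R Q') + (h *\<^sub>R Q') \<bullet> Q a)) (at a)"
    using assms unfolding has_vector_derivative_def by (intro has_derivative_inner)
  moreover have "(\<lambda>h. Q a \<bullet> (h *\<^sub>R Q') + (h *\<^sub>R Q') \<bullet> Q a) = (*) (2 * (Q a \<bullet> Q'))"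
    by (simp add: fun_eq_iff inner_commute)
  ultimately show ?thesis
    by (simp add: has_field_derivative_def power2_norm_eq_inner)
qed

text \<open>Here \<open>r\<close>, \<open>h\<close>, \<open>S\<close>, \<open>Q\<close> stand for
  \<open>\<rho>\<close>, \<open>\<theta>\<close>, \<open>S2\<close>, \<open>q\<close> along the
  material line. The grouping of the derivative anticipates the assumption \<open>De\<close> of the
  algebraic balance below; the entropy version does the same for \<open>Deta\<close>.\<close>

lemma energy_has_derivative:
  fixes r h S :: "real \<Rightarrow> real" and Q :: "real \<Rightarrow> 'a::real_inner"
  assumes "(r has_real_derivative r') (at a)" and "(h has_real_derivative h') (at a)"
    and "(S has_real_derivative S') (at a)" and "(Q has_vector_derivative Q') (at a)"
    and "r a > 0" "h a > 0" "\<kappa> > 0" "lam > 0"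
  shows "((\<lambda>s. Cv * h s + \<tau>1 / (\<kappa> * r s * h s) * (norm (Q s))\<^sup>2
              + \<tau>3 / (2 * lam * r s) * (S s)\<^sup>2) has_real_derivative
           Cv * h' + \<tau>1 / \<kappa> * (2 * (Q a \<bullet> Q') / (r a * h a)
             - (norm (Q a))\<^sup>2 * r' / ((r a)\<^sup>2 * h a) - (norm (Q a))\<^sup>2 * h' / (r a * (h a)\<^sup>2))
           + \<tau>3 / (2 * lam) * (2 * S a * S' / r a - (S a)\<^sup>2 * r' / (r a)\<^sup>2)) (at a)"
proof -
  have [derivative_intros]:
    "((\<lambda>s. (norm (Q s))\<^sup>2) has_real_derivative 2 * (Q a \<bullet> Q')) (at a)"
    using assms(4) by (rule has_real_derivative_norm_power2)
  show ?thesis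
    using assms(5-8)
    by (auto intro!: derivative_eq_intros assms(1-3))
      (simp add: field_simps power2_eq_square)
qed

lemma entropy_has_derivative:
  fixes r h :: "real \<Rightarrow> real" and Q :: "real \<Rightarrow> 'a::real_inner"
  assumes "(r has_real_derivative r') (at a)" and "(h has_real_derivative h') (at a)"
    and "(Q has_vector_derivative Q') (at a)"
    and "r a > 0" "h a > 0" "\<kappa> > 0"
  shows "((\<lambda>s. Cv * ln (h s) - R * ln (r s) + \<tau>1 / (2 * \<kappa> * (h s)\<^sup>2 * r s) * (norm (Q s))\<^sup>2)
           has_real_derivative
           Cv * h' / h a - R * r' / r a + \<tau>1 / (2 * \<kappa>) * (2 * (Q a \<bullet> Q') / ((h a)\<^sup>2 * r a)
             - 2 * (norm (Q a))\<^sup>2 * h' / ((h a) ^ 3 * r a)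
             - (norm (Q a))\<^sup>2 * r' / ((h a)\<^sup>2 * (r a)\<^sup>2))) (at a)"
proof -
  have [derivative_intros]:
    "((\<lambda>s. (norm (Q s))\<^sup>2) has_real_derivative 2 * (Q a \<bullet> Q')) (at a)"
    using assms(3) by (rule has_real_derivative_norm_power2)
  show ?thesis
    using assms(4-6)
    by (auto intro!: derivative_eq_intros assms(1-2))
      (simp add: field_simps power2_eq_square power3_eq_cube)
qed

section \<open>Pointwise algebra of the entropy production\<close>

text \<open>At a fixed point, primes are material derivatives, \<open>d\<close> is
  \<open>div u\<close>, \<open>N\<close> is the squared norm of \<open>q\<close>, and
  \<open>qDq\<close>, \<open>qh\<close> are the products of \<open>q\<close> with \<open>Dq\<close>
  and with the temperature gradient. The calculus is thereby separated from a purely real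
  identity.\<close>

lemma entropy_balance_algebra:
  fixes r h S d N :: real
  assumes pos: "r > 0" "h > 0" "\<kappa> > 0" "lam > 0"
    and mass: "r' = - r * d"
    and De: "De = Cv * h' + \<tau>1 / \<kappa> * (2 * qDq / (r * h) - N * r' / (r\<^sup>2 * h) - N * h' / (r * h\<^sup>2))
           + \<tau>3 / (2 * lam) * (2 * S * S' / r - S\<^sup>2 * r' / r\<^sup>2)"
    and Deta: "Deta = Cv * h' / h - R * r' / r + \<tau>1 / (2 * \<kappa>) * (2 * qDq / (h\<^sup>2 * r)
             - 2 * N * h' / (h ^ 3 * r) - N * r' / (h\<^sup>2 * r\<^sup>2))"
    and energy: "r * De + (R * r * h - \<tau>1 / (2 * \<kappa> * h) * N - \<tau>3 / (2 * lam) * S\<^sup>2) * d + divq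
           = visc + S * d"
    and heat: "\<tau>1 * qDq + N + \<kappa> * qh = 0"
    and bulk: "\<tau>3 * S' + S = lam * d"
  shows "r * Deta + divq / h - qh / h\<^sup>2 = N / (\<kappa> * h\<^sup>2) + S\<^sup>2 / (h * lam) + visc / h"
proof -
  have rDe: "r * De = Cv * r * h' + \<tau>1 / \<kappa> * (2 * qDq / h + N * d / h - N * h' / h\<^sup>2)
      + \<tau>3 / lam * (S * S') + \<tau>3 / (2 * lam) * S\<^sup>2 * d"
    unfolding De mass using pos by (simp add: field_simps power2_eq_square)
  have rDeta: "h * (r * Deta) = Cv * r * h' + R * r * h * d
      + \<tau>1 / (2 * \<kappa>) * (2 * qDq / h - 2 * N * h' / h\<^sup>2 + N * d / h)"
    unfolding Deta mass using pos by (simp add: field_simps power2_eq_square power3_eq_cube)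
  \<comment> \<open>The bulk relaxation law times \<open>S / lam\<close>: the part
    \<open>S * d\<close> will cancel the bulk work in the energy equation, leaving the production
    \<open>S\<^sup>2 / lam\<close>.\<close>
  have "\<tau>3 * S' = lam * d - S" using bulk by simp
  then have "\<tau>3 / lam * (S * S') = S * (lam * d - S) / lam"
    by (metis (no_types) mult.left_commute times_divide_eq_left)
  also have "\<dots> = S * d - S\<^sup>2 / lam" using pos by (simp add: field_simps power2_eq_square)
  finally have SDS: "\<tau>3 / lam * (S * S') = S * d - S\<^sup>2 / lam" .
  have "\<tau>1 * qDq = - N - \<kappa> * qh" using heat by simp
  then have "\<tau>1 / (\<kappa> * h) * qDq = (- N - \<kappa> * qh) / (\<kappa> * h)" by simp
  also have "\<dots> = - N / (\<kappa> * h) - qh / h" using pos by (simp add: field_simps)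
  finally have qDq: "\<tau>1 / (\<kappa> * h) * qDq = - N / (\<kappa> * h) - qh / h" .
  \<comment> \<open>The quadratic corrections in the pressure fit exactly: the one in
    \<open>S\<close> removes the term in \<open>S\<^sup>2 * d\<close>, and the one in
    \<open>N\<close> halves the term in \<open>N * d\<close> to the coefficient found in the
    entropy.\<close>
  have "h * (r * Deta) = (r * De + (R * r * h - \<tau>1 / (2 * \<kappa> * h) * N - \<tau>3 / (2 * lam) * S\<^sup>2) * d)
      - \<tau>1 / (\<kappa> * h) * qDq - \<tau>3 / lam * (S * S')"
    unfolding rDe rDeta using pos by (simp add: field_simps)
  also have "\<dots> = visc - divq + N / (\<kappa> * h) + qh / h + S\<^sup>2 / lam"
    using energy unfolding qDq SDS by simp
  finally have "r * Deta = (visc - divq + N / (\<kappa> * h) + qh / h + S\<^sup>2 / lam) / h"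
    using pos by (simp add: field_simps)
  \<comment> \<open>After division by \<open>h\<close>, the terms in \<open>divq\<close> and
    \<open>qh\<close> cancel against the two pieces of the divergence of
    \<open>q / \<theta>\<close>.\<close>
  then show ?thesis
    using pos by (simp add: add_divide_distrib diff_divide_distrib power2_eq_square
        mult.commute mult.left_commute)
qed

section \<open>The entropy equation for the fields\<close>

theorem lemma2p1:
  fixes \<rho> \<theta> S2 e p \<eta> :: "real ^ 'n::finite \<Rightarrow> real \<Rightarrow> real"
    and u q :: "real ^ 'n \<Rightarrow> real \<Rightarrow> real ^ 'n"
    and S1 :: "real ^ 'n \<Rightarrow> real \<Rightarrow> real ^ 'n ^ 'n"
    and \<tau>1 \<tau>3 \<kappa> lam Cv R \<mu> T :: real
  assumes dim: "CARD('n) \<in> {2, 3}"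
    and constants_pos: "\<tau>1 > 0" "\<tau>3 > 0" "\<kappa> > 0" "lam > 0" "Cv > 0" "R > 0"
    and mu: "\<mu> > 0"
    and T: "T > 0"
    and regular: "classical_regularity T \<rho> u \<theta> q S2"
    and pos: "\<And>x t. t \<in> {0<..<T} \<Longrightarrow> \<rho> x t > 0 \<and> \<theta> x t > 0"
    and e: "e = (\<lambda>x t. Cv * \<theta> x t + \<tau>1 / (\<kappa> * \<rho> x t * \<theta> x t) * (norm (q x t))\<^sup>2
                   + \<tau>3 / (2 * lam * \<rho> x t) * (S2 x t)\<^sup>2)"
    and p: "p = (\<lambda>x t. R * \<rho> x t * \<theta> x t - \<tau>1 / (2 * \<kappa> * \<theta> x t) * (norm (q x t))\<^sup>2
                   - \<tau>3 / (2 * lam) * (S2 x t)\<^sup>2)"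
    and mass: "\<And>x t. t \<in> {0<..<T} \<Longrightarrow>
          time_deriv \<rho> x t + divergence (\<lambda>y. \<rho> y t *\<^sub>R u y t) x = 0"
    and momentum: "\<And>x t. t \<in> {0<..<T} \<Longrightarrow>
          \<rho> x t *\<^sub>R time_deriv u x t + \<rho> x t *\<^sub>R advect (u x t) (\<lambda>y. u y t) x + grad (\<lambda>y. p y t) x
          = \<mu> *\<^sub>R divergence_mat (deviator (\<lambda>y. u y t)) x + grad (\<lambda>y. S2 y t) x"
    and energy: "\<And>x t. t \<in> {0<..<T} \<Longrightarrow>
          \<rho> x t * time_deriv e x t + \<rho> x t * advect (u x t) (\<lambda>y. e y t) x
            + p x t * divergence (\<lambda>y. u y t) x + divergence (\<lambda>y. q y t) x
          = \<mu> * ddot (deviator (\<lambda>y. u y t) x) (grad_vec (\<lambda>y. u y t) x)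
            + S2 x t * divergence (\<lambda>y. u y t) x"
    and heat_flux: "\<And>x t. t \<in> {0<..<T} \<Longrightarrow>
          \<tau>1 *\<^sub>R (time_deriv q x t + advect (u x t) (\<lambda>y. q y t) x) + q x t
            + \<kappa> *\<^sub>R grad (\<lambda>y. \<theta> y t) x = 0"
    and bulk_stress: "\<And>x t. t \<in> {0<..<T} \<Longrightarrow>
          \<tau>3 * (time_deriv S2 x t + advect (u x t) (\<lambda>y. S2 y t) x) + S2 x t
          = lam * divergence (\<lambda>y. u y t) x"
    and eta: "\<eta> = (\<lambda>x t. Cv * ln (\<theta> x t) - R * ln (\<rho> x t)
                   + \<tau>1 / (2 * \<kappa> * (\<theta> x t)\<^sup>2 * \<rho> x t) * (norm (q x t))\<^sup>2)"
    and S1: "S1 = (\<lambda>x t. \<mu> *\<^sub>R deviator (\<lambda>y. u y t) x)"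
  shows "\<forall>x. \<forall>t\<in>{0<..<T}.
          time_deriv (\<lambda>y s. \<rho> y s * \<eta> y s) x t
            + divergence (\<lambda>y. (\<rho> y t * \<eta> y t) *\<^sub>R u y t) x
            + divergence (\<lambda>y. (1 / \<theta> y t) *\<^sub>R q y t) x
          = (norm (q x t))\<^sup>2 / (\<kappa> * (\<theta> x t)\<^sup>2) + (S2 x t)\<^sup>2 / (\<theta> x t * lam)
            + ddot (S1 x t) (S1 x t) / (2 * \<mu> * \<theta> x t)"
proof (intro allI ballI)
  fix x :: "real ^ 'n" and t :: real
  assume t: "t \<in> {0<..<T}"
  note pos_xt = pos[OF t, of x]
  let ?z = "(x, t)"
  let ?D = "\<lambda>f. time_deriv f x t + advect (u x t) (\<lambda>y. f y t) x"
  have d\<rho>: "(\<lambda>(x, t). \<rho> x t) differentiable (at ?z)"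
    and d\<theta>: "(\<lambda>(x, t). \<theta> x t) differentiable (at ?z)"
    and dS: "(\<lambda>(x, t). S2 x t) differentiable (at ?z)"
    and du: "(\<lambda>(x, t). u x t) differentiable (at ?z)"
    and dq: "(\<lambda>(x, t). q x t) differentiable (at ?z)"
    using regular t
    by (auto simp: classical_regularity_def Let_def intro: cont_diff_on_imp_differentiable)
  have d': "(\<lambda>z. \<rho> (fst z) (snd z)) differentiable (at ?z)"
    "(\<lambda>z. \<theta> (fst z) (snd z)) differentiable (at ?z)"
    "(\<lambda>z. S2 (fst z) (snd z)) differentiable (at ?z)"
    "(\<lambda>z. q (fst z) (snd z)) differentiable (at ?z)"
    using d\<rho> d\<theta> dS dq by (simp_all add: case_prod_beta')
  \<comment> \<open>Regularity is assumed for the primitive fields only; \<open>e\<close> and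
    \<open>\<eta>\<close> inherit differentiability because positivity keeps denominators and
    logarithms in range.\<close>
  have de: "(\<lambda>(x, t). e x t) differentiable (at ?z)"
    unfolding e case_prod_beta' power2_norm_eq_inner using pos_xt constants_pos
    by (intro differentiable_add differentiable_mult differentiable_divide differentiable_inner
        differentiable_power differentiable_const d') auto
  have d\<eta>: "(\<lambda>(x, t). \<eta> x t) differentiable (at ?z)"
    unfolding eta case_prod_beta' power2_norm_eq_inner using pos_xt constants_pos
    by (intro differentiable_add differentiable_diff differentiable_mult differentiable_divide
        differentiable_inner differentiable_power differentiable_const differentiable_ln d') auto
  have d\<rho>\<eta>: "(\<lambda>(x, t). \<rho> x t * \<eta> x t) differentiable (at ?z)"
    using differentiable_mult[OF d\<rho> d\<eta>] by (simp add: case_prod_beta')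
  note material = has_vector_derivative_material[where v = "u x t" and x = x and t = t]
  have D: "((\<lambda>s. f (x + s *\<^sub>R u x t) (t + s)) has_real_derivative ?D f) (at 0)"
    if "(\<lambda>(x, t). f x t) differentiable (at ?z)" for f :: "real ^ 'n \<Rightarrow> real \<Rightarrow> real"
    using material[OF that] by (simp add: has_real_derivative_iff_has_vector_derivative)
  note Dq = material[OF dq]

  \<comment> \<open>Both derivatives are of the same function of \<open>s\<close> at
    \<open>0\<close>, so they agree by uniqueness.\<close>
  have De: "?D e = Cv * ?D \<theta> + \<tau>1 / \<kappa> * (2 * (q x t \<bullet> ?D q) / (\<rho> x t * \<theta> x t)
        - (norm (q x t))\<^sup>2 * ?D \<rho> / ((\<rho> x t)\<^sup>2 * \<theta> x t)
        - (norm (q x t))\<^sup>2 * ?D \<theta> / (\<rho> x t * (\<theta> x t)\<^sup>2))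
      + \<tau>3 / (2 * lam) * (2 * S2 x t * ?D S2 / \<rho> x t - (S2 x t)\<^sup>2 * ?D \<rho> / (\<rho> x t)\<^sup>2)"
    using DERIV_unique[OF D[OF de, unfolded e]
        energy_has_derivative[OF D[OF d\<rho>] D[OF d\<theta>] D[OF dS] Dq]] pos_xt constants_pos
    by (simp add: e)
  have D\<eta>: "?D \<eta> = Cv * ?D \<theta> / \<theta> x t - R * ?D \<rho> / \<rho> x t
      + \<tau>1 / (2 * \<kappa>) * (2 * (q x t \<bullet> ?D q) / ((\<theta> x t)\<^sup>2 * \<rho> x t)
        - 2 * (norm (q x t))\<^sup>2 * ?D \<theta> / ((\<theta> x t) ^ 3 * \<rho> x t)
        - (norm (q x t))\<^sup>2 * ?D \<rho> / ((\<theta> x t)\<^sup>2 * (\<rho> x t)\<^sup>2))"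
    using DERIV_unique[OF D[OF d\<eta>, unfolded eta]
        entropy_has_derivative[OF D[OF d\<rho>] D[OF d\<theta>] Dq]] pos_xt constants_pos
    by (simp add: eta)
  have D\<rho>\<eta>: "?D (\<lambda>y s. \<rho> y s * \<eta> y s) = \<rho> x t * ?D \<eta> + \<eta> x t * ?D \<rho>"
    using DERIV_unique[OF D[OF d\<rho>\<eta>] DERIV_mult[OF D[OF d\<rho>] D[OF d\<eta>]]]
    by (simp add: algebra_simps)

  let ?d = "divergence (\<lambda>y. u y t) x"
  note slice = differentiable_time_slice
  have mass': "?D \<rho> = - \<rho> x t * ?d"
    using mass[OF t, of x] divergence_scaleR[OF slice[OF d\<rho>] slice[OF du]] by simp
  have energy': "\<rho> x t * ?D e
      + (R * \<rho> x t * \<theta> x t - \<tau>1 / (2 * \<kappa> * \<theta> x t) * (norm (q x t))\<^sup>2 - \<tau>3 / (2 * lam) * (S2 x t)\<^sup>2) * ?d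
      + divergence (\<lambda>y. q y t) x
      = ddot (S1 x t) (S1 x t) / (2 * \<mu>) + S2 x t * ?d"
  proof -
    \<comment> \<open>The factor \<open>\<mu>\<^sup>2\<close> together with the \<open>2\<close>
      from the deviator identity explains the denominator \<open>2 * \<mu>\<close> of the
      dissipation.\<close>
    have "ddot (S1 x t) (S1 x t)
        = \<mu>\<^sup>2 * ddot (deviator (\<lambda>y. u y t) x) (deviator (\<lambda>y. u y t) x)"
      by (simp add: S1 ddot_def sum_distrib_left power2_eq_square mult_ac)
    then have "ddot (S1 x t) (S1 x t) / (2 * \<mu>)
        = \<mu> * ddot (deviator (\<lambda>y. u y t) x) (grad_vec (\<lambda>y. u y t) x)"
      using mu by (simp add: ddot_deviator_self power2_eq_square)
    then show ?thesis
      using energy[OF t, of x] by (simp add: p distrib_left)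
  qed
  \<comment> \<open>Inner product of the heat flux law with \<open>q\<close>; the product of
    \<open>q\<close> with the temperature gradient is written as advection along \<open>q\<close>,
    not along \<open>u\<close>.\<close>
  have heat': "\<tau>1 * (q x t \<bullet> ?D q) + (norm (q x t))\<^sup>2 + \<kappa> * advect (q x t) (\<lambda>y. \<theta> y t) x = 0"
    using arg_cong[OF heat_flux[OF t, of x], of "inner (q x t)"]
    by (simp add: inner_add_right inner_grad power2_norm_eq_inner)
  note balance = entropy_balance_algebra[OF _ _ _ _ mass' De D\<eta> energy' heat' bulk_stress[OF t]]

  have recip: "(\<lambda>y. 1 / \<theta> y t) differentiable (at x)"
    using slice[OF d\<theta>] pos_xt by (intro differentiable_divide differentiable_const) auto
  \<comment> \<open>With time frozen, the reciprocal rule along the line in direction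
    \<open>q\<close> gives the gradient part of the divergence of
    \<open>q / \<theta>\<close>.\<close>
  have "((\<lambda>s. \<theta> (x + s *\<^sub>R q x t) t) has_real_derivative advect (q x t) (\<lambda>y. \<theta> y t) x) (at 0)"
    using has_vector_derivative_advect[OF slice[OF d\<theta>]]
    by (simp add: has_real_derivative_iff_has_vector_derivative)
  then have "((\<lambda>s. 1 / \<theta> (x + s *\<^sub>R q x t) t) has_real_derivative
      - advect (q x t) (\<lambda>y. \<theta> y t) x / (\<theta> x t)\<^sup>2) (at 0)"
    using pos_xt by (auto intro!: derivative_eq_intros simp: power2_eq_square)
  then have "advect (q x t) (\<lambda>y. 1 / \<theta> y t) x = - advect (q x t) (\<lambda>y. \<theta> y t) x / (\<theta> x t)\<^sup>2"
    using DERIV_unique has_vector_derivative_advect[OF recip]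
    by (fastforce simp: has_real_derivative_iff_has_vector_derivative)
  then have flux: "divergence (\<lambda>y. (1 / \<theta> y t) *\<^sub>R q y t) x
      = divergence (\<lambda>y. q y t) x / \<theta> x t - advect (q x t) (\<lambda>y. \<theta> y t) x / (\<theta> x t)\<^sup>2"
    using divergence_scaleR[OF recip slice[OF dq]] by simp
  have "time_deriv (\<lambda>y s. \<rho> y s * \<eta> y s) x t + divergence (\<lambda>y. (\<rho> y t * \<eta> y t) *\<^sub>R u y t) x
      = ?D (\<lambda>y s. \<rho> y s * \<eta> y s) + \<rho> x t * \<eta> x t * ?d"
    using divergence_scaleR[OF slice[OF d\<rho>\<eta>] slice[OF du]] by simp
  \<comment> \<open>The coefficient of \<open>\<eta>\<close> is
    \<open>D\<rho> + \<rho> div u\<close>, which vanishes by mass conservation.\<close>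
  also have "\<dots> = \<rho> x t * ?D \<eta>"
    unfolding D\<rho>\<eta> mass' by simp
  finally show "time_deriv (\<lambda>y s. \<rho> y s * \<eta> y s) x t
        + divergence (\<lambda>y. (\<rho> y t * \<eta> y t) *\<^sub>R u y t) x
        + divergence (\<lambda>y. (1 / \<theta> y t) *\<^sub>R q y t) x
      = (norm (q x t))\<^sup>2 / (\<kappa> * (\<theta> x t)\<^sup>2) + (S2 x t)\<^sup>2 / (\<theta> x t * lam)
        + ddot (S1 x t) (S1 x t) / (2 * \<mu> * \<theta> x t)"
    using balance pos_xt constants_pos by (simp add: flux)
qed

end
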